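(* Let $a$ be a positive integer. Write $n = \lfloor \sqrt{a} \rfloor$ and $b = a - n^2$ (so $0 \le b \le 2n$), and $m = n+1$ and $c = m^2 - a$ (so $1 \le c \le 2m-1$). Define $$\sigma_l(a) = \frac{n + \sqrt{a+1}}{b+1}, \qquad \sigma_r(a) = \frac{m + \sqrt{a}}{c},$$ and for a positive integer $k$ define $\sigma_k(a) = \lfloor \max\{k\,\sigma_l(a),\, k\,\sigma_r(a)\} \rfloor + 1$. Then: (1) For every positive integer $k$ and every positive integer $s$, if $s \le \max\{k\,\sigma_l(a),\, k\,\sigma_r(a)\}$ then $\tau_s(a) < k$. (2) For every positive integer $k$ and every positive integer $s$, if $\tau_s(a) \ge k$ then $s \ge \sigma_k(a)$. (3) $\sigma_1(a) \le \sigma(a) \le \lceil \sqrt{a+1} + \sqrt{a} \rceil$.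
   Context: For a positive integer $a$ and a positive integer $s$, let $T_s(a)$ be the set of all positive integers $t$ with $s^2 a < t^2 < s^2(a+1)$, and let $\tau_s(a) = |T_s(a)|$. Let $\sigma(a)$ be the least positive integer $s$ such that $T_s(a) \neq \varnothing$ (equivalently, the smallest denominator of a rational number in the open interval $(\sqrt{a}, \sqrt{a+1})$). *)

theory Defs
  imports Complex_Main
begin

definition T_set :: "nat \<Rightarrow> nat \<Rightarrow> nat set" where
  "T_set s a = {t. 0 < t \<and> s\<^sup>2 * a < t\<^sup>2 \<and> t\<^sup>2 < s\<^sup>2 * (a + 1)}"

definition tau :: "nat \<Rightarrow> nat \<Rightarrow> nat" where
  "tau s a = card (T_set s a)"

definition sigma :: "nat \<Rightarrow> nat" where
  "sigma a = (LEAST s. 0 < s \<and> T_set s a \<noteq> {})"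

definition n_of :: "nat \<Rightarrow> int" where
  "n_of a = \<lfloor>sqrt (real a)\<rfloor>"

definition b_of :: "nat \<Rightarrow> int" where
  "b_of a = int a - (n_of a)\<^sup>2"

definition m_of :: "nat \<Rightarrow> int" where
  "m_of a = n_of a + 1"

definition c_of :: "nat \<Rightarrow> int" where
  "c_of a = (m_of a)\<^sup>2 - int a"

definition sigma_l :: "nat \<Rightarrow> real" where
  "sigma_l a = (of_int (n_of a) + sqrt (real a + 1)) / (of_int (b_of a) + 1)"

definition sigma_r :: "nat \<Rightarrow> real" where
  "sigma_r a = (of_int (m_of a) + sqrt (real a)) / of_int (c_of a)"

definition sigma_k :: "nat \<Rightarrow> nat \<Rightarrow> int" where
  "sigma_k k a = \<lfloor>max (real k * sigma_l a) (real k * sigma_r a)\<rfloor> + 1"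

(* No junk values occur: the counted sets are finite, sigma is a least element of a
   nonempty set, and the denominators of sigma_l and sigma_r are positive. *)

lemma finite_T_set: "finite (T_set s a)"
proof (rule finite_subset)
  show "T_set s a \<subseteq> {..s\<^sup>2 * (a + 1)}"
  proof
    fix t assume "t \<in> T_set s a"
    then have "t\<^sup>2 < s\<^sup>2 * (a + 1)" by (simp add: T_set_def)
    moreover have "t \<le> t\<^sup>2" by (simp add: power2_eq_square)
    ultimately show "t \<in> {..s\<^sup>2 * (a + 1)}" by simp
  qed
qed simp

lemma T_set_nonempty: "\<exists>s>0. T_set s a \<noteq> {}"
proof -
  have "sqrt (real a) < sqrt (real a + 1)" by simp
  then obtain r where r: "r \<in> \<rat>" "sqrt (real a) < r" "r < sqrt (real a + 1)"
    using Rats_dense_in_real by blast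
  have r0: "0 < r" using r(2) real_sqrt_ge_zero[of "real a"] by linarith
  obtain t s :: nat where ts: "s \<noteq> 0" "\<bar>r\<bar> = real t / real s"
    using Rats_abs_nat_div_natE[OF r(1)] by metis
  have rs: "real t = r * real s" using ts r0 by simp
  have t0: "0 < t" using rs r0 ts(1) by (metis mult_pos_pos of_nat_0_less_iff neq0_conv)
  have "real a < r\<^sup>2" using power_strict_mono[OF r(2), of 2] by simp
  moreover have "r\<^sup>2 < real a + 1"
    using power_strict_mono[OF r(3), of 2] r0 by simp
  ultimately have "real a * (real s)\<^sup>2 < r\<^sup>2 * (real s)\<^sup>2"
      "r\<^sup>2 * (real s)\<^sup>2 < (real a + 1) * (real s)\<^sup>2"
    using ts(1) by (intro mult_strict_right_mono; simp)+
  then have "real (s\<^sup>2 * a) < real (t\<^sup>2)" "real (t\<^sup>2) < real (s\<^sup>2 * (a + 1))"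
    by (simp_all add: rs power_mult_distrib algebra_simps)
  then have "t \<in> T_set s a"
    using t0 by (simp only: T_set_def of_nat_less_iff mem_Collect_eq)
  then show ?thesis using ts(1) by auto
qed

lemma b_of_bounds: "0 \<le> b_of a" "b_of a \<le> 2 * n_of a"
  and c_of_bounds: "1 \<le> c_of a" "c_of a \<le> 2 * m_of a - 1"
proof -
  define n where "n = n_of a"
  have n0: "0 \<le> n" by (simp add: n_def n_of_def)
  have lo: "of_int n \<le> sqrt (real a)" and hi: "sqrt (real a) < of_int n + 1"
    by (simp_all add: n_def n_of_def)
  have "(of_int n)\<^sup>2 \<le> (sqrt (real a))\<^sup>2" using lo n0 by (intro power_mono) auto
  then have "real_of_int (n\<^sup>2) \<le> of_int (int a)" by simp
  then have 1: "n\<^sup>2 \<le> int a" by (simp only: of_int_le_iff)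
  have "(sqrt (real a))\<^sup>2 < (of_int n + 1)\<^sup>2" using hi by (intro power_strict_mono) auto
  then have "real_of_int (int a) < of_int ((n + 1)\<^sup>2)" by simp
  then have 2: "int a < (n + 1)\<^sup>2" by (simp only: of_int_less_iff)
  show "0 \<le> b_of a" "b_of a \<le> 2 * n_of a" "1 \<le> c_of a" "c_of a \<le> 2 * m_of a - 1"
    using 1 2 by (simp_all add: b_of_def c_of_def m_of_def n_def power2_eq_square algebra_simps)
qed

end

(* Rationalising the denominators, sigma_l a = 1 / (sqrt (a + 1) - n) and
   sigma_r a = 1 / (m - sqrt a). The elements of T_s(a) are the integers strictly between
   s sqrt a and s sqrt (a + 1), and they all lie strictly between s n and s m. So k of them
   force s n + k < s sqrt (a + 1) and s sqrt a < s m - k, that is s > k sigma_l a and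
   s > k sigma_r a. For the upper bound on sigma, an s of size at least
   sqrt (a + 1) + sqrt a makes the interval at least 1 long; it could miss every integer only if
   s sqrt a and s sqrt (a + 1) were consecutive integers, which is impossible for a > 0. *)

theory Submission
  imports Defs
begin

text \<open>Trades the squared conditions on naturals for real bounds linear in \<open>s\<close>.
  The value \<open>t = 0\<close> fails on both sides, so positivity of \<open>t\<close> costs
  nothing.\<close>

lemma mem_T_set_iff:
  assumes "s > 0"
  shows "t \<in> T_set s a \<longleftrightarrow> s * sqrt a < t \<and> t < s * sqrt (real a + 1)"
proof -
  have root: "real s * sqrt x = sqrt ((real s)\<^sup>2 * x)" for x
    by (simp add: real_sqrt_mult)
  have "s * sqrt a < t \<longleftrightarrow> sqrt (real (s\<^sup>2 * a)) < sqrt (real (t\<^sup>2))"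
    by (simp add: root)
  then have l: "s * sqrt a < t \<longleftrightarrow> s\<^sup>2 * a < t\<^sup>2"
    by (simp only: real_sqrt_less_iff of_nat_less_iff)
  have "t < s * sqrt (real a + 1) \<longleftrightarrow> sqrt (real (t\<^sup>2)) < sqrt (real (s\<^sup>2 * (a + 1)))"
    by (simp add: root distrib_left add.commute)
  then have r: "t < s * sqrt (real a + 1) \<longleftrightarrow> t\<^sup>2 < s\<^sup>2 * (a + 1)"
    by (simp only: real_sqrt_less_iff of_nat_less_iff)
  show ?thesis
    unfolding l r T_set_def by (cases "t = 0") auto
qed

lemma n_of_bounds:
  shows "0 \<le> n_of a" "n_of a \<le> sqrt a" "sqrt a < m_of a"
  by (simp_all add: n_of_def m_of_def)

lemma n_of_less_sqrt_Suc: "n_of a < sqrt (real a + 1)"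
  using n_of_bounds(2)[of a] real_sqrt_less_mono[of "real a" "real a + 1"] by linarith

lemma sigma_l_eq: "sigma_l a = 1 / (sqrt (real a + 1) - n_of a)"
proof -
  \<comment> \<open>\<open>b + 1 = (a + 1) - n^2\<close> is a difference of squares;
    \<open>c = m^2 - a\<close> factors likewise for \<open>sigma_r\<close>.\<close>
  have "of_int (b_of a) + (1::real) = (sqrt (real a + 1) - n_of a) * (n_of a + sqrt (real a + 1))"
    by (simp add: b_of_def algebra_simps power2_eq_square)
  then show ?thesis
    using n_of_bounds(1)[of a] n_of_less_sqrt_Suc[of a] by (simp add: sigma_l_def)
qed

lemma sigma_r_eq: "sigma_r a = 1 / (m_of a - sqrt a)"
proof -
  have "(of_int (c_of a) :: real) = (m_of a - sqrt a) * (m_of a + sqrt a)"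
    by (simp add: c_of_def algebra_simps power2_eq_square)
  moreover have "(0::real) < m_of a + sqrt a"
    using n_of_bounds(3)[of a] real_sqrt_ge_zero[of "real a"] by linarith
  ultimately show ?thesis
    by (simp add: sigma_r_def)
qed

text \<open>The contrapositive of claim (1). Its strict inequality is what yields the
  \<open>+ 1\<close> in \<open>sigma_k\<close>.\<close>

lemma less_of_tau_ge:
  assumes "k > 0" "s > 0" "tau s a \<ge> k"
  shows "max (k * sigma_l a) (k * sigma_r a) < s"
proof -
  let ?T = "int ` T_set s a"
  have fin: "finite ?T"
    by (simp add: finite_T_set)
  have card: "k \<le> card ?T"
    using assms(3) by (simp add: tau_def card_image)
  then have ne: "?T \<noteq> {}"
    using assms(1) by auto
  have T: "real s * sqrt a < x" "x < real s * sqrt (real a + 1)" if "x \<in> ?T" for x :: int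
    using that mem_T_set_iff[OF assms(2)] by auto
  have lower: "int s * n_of a < x" if "x \<in> ?T" for x
  proof -
    have "real s * n_of a \<le> real s * sqrt a"
      using n_of_bounds(2) by (intro mult_left_mono) auto
    then have "of_int (int s * n_of a) < (of_int x :: real)"
      using T(1)[OF that] by simp
    then show ?thesis by (simp only: of_int_less_iff)
  qed
  have upper: "x < int s * m_of a" if "x \<in> ?T" for x
  proof -
    \<comment> \<open>Integrality turns \<open>a < m^2\<close> into \<open>a + 1 \<le> m^2\<close>.
      Equality may occur; strictness in \<open>upper\<close> comes from \<open>T(2)\<close>.\<close>
    have "sqrt (real a + 1) \<le> m_of a"
    proof -
      have "int a + 1 \<le> (m_of a)\<^sup>2"
        using c_of_bounds(1)[of a] by (simp add: c_of_def)
      then have "real_of_int (int a + 1) \<le> of_int ((m_of a)\<^sup>2)"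
        by (simp only: of_int_le_iff)
      then have "real a + 1 \<le> (of_int (m_of a))\<^sup>2"
        by simp
      then show ?thesis
        using n_of_bounds(1)[of a] by (intro real_le_lsqrt) (auto simp: m_of_def)
    qed
    then have "real s * sqrt (real a + 1) \<le> real s * m_of a"
      by (intro mult_left_mono) auto
    then have "of_int x < (of_int (int s * m_of a) :: real)"
      using T(2)[OF that] by simp
    then show ?thesis by (simp only: of_int_less_iff)
  qed
  \<comment> \<open>This interval has \<open>nat (Max ?T - s n)\<close> elements;
    \<open>lower\<close> at the maximum makes the difference positive, so \<open>nat\<close>
    truncates nothing.\<close>
  have "?T \<subseteq> {int s * n_of a<..Max ?T}"
    using lower fin by auto
  from card_mono[OF _ this] have "int s * n_of a + k \<le> Max ?T"
    using card lower[OF Max_in[OF fin ne]] by simp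
  then have "real_of_int (int s * n_of a + k) \<le> Max ?T"
    by (simp only: of_int_le_iff)
  then have "real k < real s * (sqrt (real a + 1) - n_of a)"
    using T(2)[OF Max_in[OF fin ne]] by (simp add: algebra_simps)
  then have l: "k * sigma_l a < s"
    using n_of_less_sqrt_Suc[of a] by (simp add: sigma_l_eq divide_less_eq)
  have "?T \<subseteq> {Min ?T..<int s * m_of a}"
    using upper fin by auto
  from card_mono[OF _ this] have "Min ?T + k \<le> int s * m_of a"
    using card upper[OF Min_in[OF fin ne]] by simp
  then have "real_of_int (Min ?T + k) \<le> of_int (int s * m_of a)"
    by (simp only: of_int_le_iff)
  then have "real k < real s * (m_of a - sqrt a)"
    using T(1)[OF Min_in[OF fin ne]] by (simp add: algebra_simps)
  then have "k * sigma_r a < s"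
    using n_of_bounds(3)[of a] by (simp add: sigma_r_eq divide_less_eq)
  with l show ?thesis by simp
qed

lemma sigma_k_le_of_tau_ge:
  assumes "k > 0" "s > 0" "tau s a \<ge> k"
  shows "sigma_k k a \<le> int s"
  using less_of_tau_ge[OF assms] unfolding sigma_k_def by linarith

lemma T_set_nonempty_of_ge:
  assumes "a > 0" "s > 0" "sqrt (real a + 1) + sqrt a \<le> s"
  shows "T_set s a \<noteq> {}"
proof -
  \<comment> \<open>The least integer strictly above \<open>s * sqrt a\<close>, the only candidate
    that has to be tested.\<close>
  define t where "t = nat (\<lfloor>s * sqrt a\<rfloor> + 1)"
  have "0 \<le> s * sqrt a" by simp
  then have t: "s * sqrt a < t" "t \<le> s * sqrt a + 1"
    unfolding t_def by linarith+
  \<comment> \<open>Again a difference of squares, \<open>(a + 1) - a\<close>; it makes the interval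
    at least 1 long.\<close>
  have "1 = (sqrt (real a + 1) + sqrt a) * (sqrt (real a + 1) - sqrt a)"
    by (simp add: algebra_simps)
  also have "\<dots> \<le> s * (sqrt (real a + 1) - sqrt a)"
    using assms(3) by (intro mult_right_mono) auto
  finally have len: "s * sqrt a + 1 \<le> s * sqrt (real a + 1)"
    by (simp add: algebra_simps)
  have "t \<noteq> s * sqrt (real a + 1)"
  proof
    assume eq: "t = s * sqrt (real a + 1)"
    \<comment> \<open>Equality at the right end forces length exactly 1, so both ends are
      integers.\<close>
    then have "real t - 1 = s * sqrt a"
      using t len by linarith
    then have "(real t - 1)\<^sup>2 = (real s)\<^sup>2 * a"
      by (simp add: power_mult_distrib)
    then have "real_of_int ((int t - 1)\<^sup>2) = of_int ((int s)\<^sup>2 * a)"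
      by simp
    then have 1: "(int t - 1)\<^sup>2 = (int s)\<^sup>2 * a"
      by (simp only: of_int_eq_iff)
    have "(real t)\<^sup>2 = (real s)\<^sup>2 * (real a + 1)"
      using eq by (simp add: power_mult_distrib)
    then have "real_of_int ((int t)\<^sup>2) = of_int ((int s)\<^sup>2 * (int a + 1))"
      by simp
    then have 2: "(int t)\<^sup>2 = (int s)\<^sup>2 * (int a + 1)"
      by (simp only: of_int_eq_iff)
    have "2 * int t - 1 = (int s)\<^sup>2"
      using 1 2 by (simp add: algebra_simps power2_eq_square)
    then have "(int t)\<^sup>2 = (2 * int t - 1) * (int a + 1)"
      using 2 by simp
    \<comment> \<open>Since \<open>4 t^2 = (2 t - 1) (2 t + 1) + 1\<close>, the factor
      \<open>2 t - 1\<close> divides 1.\<close>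
    then have "(2 * int t - 1) * (4 * (int a + 1) - (2 * int t + 1)) = 1"
      by algebra
    then have "\<bar>2 * int t - 1\<bar> = 1"
      by (metis abs_zmult_eq_1 abs_one)
    moreover have "0 < t"
      using t(1) \<open>0 \<le> s * sqrt a\<close> by linarith
    ultimately have "t = 1" by linarith
    \<comment> \<open>At \<open>t = 1\<close> the equation reads \<open>0 = s^2 a\<close>.\<close>
    with 1 show False
      using assms(1,2) by simp
  qed
  with t len have "t \<in> T_set s a"
    unfolding mem_T_set_iff[OF assms(2)] by linarith
  then show ?thesis by blast
qed

theorem theorem2:
  fixes a :: nat
  assumes "a > 0"
  shows "(\<forall>k s :: nat. k > 0 \<longrightarrow> s > 0 \<longrightarrow>
            real s \<le> max (real k * sigma_l a) (real k * sigma_r a) \<longrightarrow> tau s a < k) \<and>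
         (\<forall>k s :: nat. k > 0 \<longrightarrow> s > 0 \<longrightarrow> tau s a \<ge> k \<longrightarrow> int s \<ge> sigma_k k a) \<and>
         (sigma_k 1 a \<le> int (sigma a) \<and> int (sigma a) \<le> \<lceil>sqrt (real a + 1) + sqrt (real a)\<rceil>)"
proof (intro conjI allI impI)
  fix k s :: nat
  assume "k > 0" "s > 0" "real s \<le> max (real k * sigma_l a) (real k * sigma_r a)"
  then show "tau s a < k"
    using less_of_tau_ge[of k s a] by (meson not_le)
next
  fix k s :: nat
  assume "k > 0" "s > 0" "tau s a \<ge> k"
  then show "int s \<ge> sigma_k k a"
    by (rule sigma_k_le_of_tau_ge)
next
  \<comment> \<open>The minimum is attained, so \<open>tau (sigma a) a \<ge> 1\<close> and the case
    \<open>k = 1\<close> applies.\<close>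
  have "0 < sigma a \<and> T_set (sigma a) a \<noteq> {}"
    unfolding sigma_def using T_set_nonempty[of a] by (rule LeastI_ex)
  then show "sigma_k 1 a \<le> int (sigma a)"
    by (intro sigma_k_le_of_tau_ge) (auto simp: tau_def Suc_le_eq card_gt_0_iff finite_T_set)
next
  define s where "s = nat \<lceil>sqrt (real a + 1) + sqrt a\<rceil>"
  have "0 < sqrt (real a + 1) + sqrt a"
    using assms by (simp add: add_pos_pos)
  then have s: "s > 0" "sqrt (real a + 1) + sqrt a \<le> s"
      "int s = \<lceil>sqrt (real a + 1) + sqrt a\<rceil>"
    unfolding s_def by linarith+
  \<comment> \<open>The ceiling is itself an admissible denominator, so minimality bounds
    \<open>sigma a\<close>.\<close>
  have "sigma a \<le> s"
    unfolding sigma_def using s(1) T_set_nonempty_of_ge[OF assms s(1,2)] by (intro Least_le) simp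
  then show "int (sigma a) \<le> \<lceil>sqrt (real a + 1) + sqrt (real a)\<rceil>"
    using s(3) by linarith
qed

end
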